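(* For all Lorenz hulls $H_1,H_2,H_3,H_4\subseteq\mathbb{R}^n$: if $H_1\subseteq H_3$ and $H_2\subseteq H_4$, then $H_1H_2\subseteq H_3H_4$, where juxtaposition denotes the Lorenz product.
   Context: An $n$-dimensional finite signed vector measure on a measurable space $(S,\mathcal{F})$ is an $n$-tuple $\boldsymbol{\mu}=(\mu_1,\dots,\mu_n)$ of finite signed measures on $(S,\mathcal{F})$, viewed as a map $\boldsymbol{\mu}:\mathcal{F}\to\mathbb{R}^n$. Its Lorenz hull $\mathsf{LH}(\boldsymbol{\mu})$ is the convex hull of its range $\{\boldsymbol{\mu}(A):A\in\mathcal{F}\}$. A Lorenz hull in $\mathbb{R}^n$ is a set of the form $\mathsf{LH}(\boldsymbol{\mu})$ for some such $\boldsymbol{\mu}$ on some measurable space. For $n$-dimensional finite signed vector measures $\boldsymbol{\alpha}=(\alpha_1,\dots,\alpha_n)$ on $(S,\mathcal{F})$ and $\boldsymbol{\beta}=(\beta_1,\dots,\beta_n)$ on $(T,\mathcal{G})$, $\boldsymbol{\alpha}\times\boldsymbol{\beta}:=(\alpha_1\times\beta_1,\dots,\alpha_n\times\beta_n)$ on the product measurable space, where $\alpha_i\times\beta_i$ is the unique finite signed measure with $(\alpha_i\times\beta_i)(A\times B)=\alpha_i(A)\beta_i(B)$ for all $A\in\mathcal{F}$, $B\in\mathcal{G}$. The Lorenz product of Lorenz hulls $H=\mathsf{LH}(\boldsymbol{\alpha})$ and $H'=\mathsf{LH}(\boldsymbol{\beta})$ is $HH':=\mathsf{LH}(\boldsymbol{\alpha}\times\boldsymbol{\beta})$;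 this set depends only on $H$ and $H'$, so the product is well defined. *)

theory Defs
  imports "HOL-Analysis.Analysis"
begin

text \<open>
  A value of type \<open>'a measure\<close> serves here only as a measurable space: \<open>space M\<close> and
  \<open>sets M\<close> are used, its \<open>emeasure\<close> never is. Set functions are constrained on \<open>sets M\<close> only.
\<close>

definition finite_signed_measure :: "'a measure \<Rightarrow> ('a set \<Rightarrow> real) \<Rightarrow> bool" where
  "finite_signed_measure M \<mu> \<longleftrightarrow>
     \<mu> {} = 0 \<and>
     (\<forall>A :: nat \<Rightarrow> 'a set. range A \<subseteq> sets M \<longrightarrow> disjoint_family A \<longrightarrow>
        (\<lambda>k. \<mu> (A k)) sums \<mu> (\<Union>k. A k))"

definition signed_vector_measure :: "'a measure \<Rightarrow> ('a set \<Rightarrow> real ^ 'n) \<Rightarrow> bool" where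
  "signed_vector_measure M \<mu> \<longleftrightarrow> (\<forall>i. finite_signed_measure M (\<lambda>A. \<mu> A $ i))"

text \<open>
  Membership in \<^const>\<open>extensional\<close> fixes the irrelevant values outside the product
  sigma-algebra, so that the product signed measure is unique as a function.
\<close>

definition signed_product ::
    "'a measure \<Rightarrow> ('a set \<Rightarrow> real) \<Rightarrow> 'b measure \<Rightarrow> ('b set \<Rightarrow> real) \<Rightarrow> ('a \<times> 'b) set \<Rightarrow> real" where
  "signed_product M \<mu> N \<nu> =
     (THE \<rho>. finite_signed_measure (M \<Otimes>\<^sub>M N) \<rho> \<and>
             (\<forall>A\<in>sets M. \<forall>B\<in>sets N. \<rho> (A \<times> B) = \<mu> A * \<nu> B) \<and>
             \<rho> \<in> extensional (sets (M \<Otimes>\<^sub>M N)))"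

definition vector_product ::
    "'a measure \<Rightarrow> ('a set \<Rightarrow> real ^ 'n) \<Rightarrow> 'b measure \<Rightarrow> ('b set \<Rightarrow> real ^ 'n)
      \<Rightarrow> ('a \<times> 'b) set \<Rightarrow> real ^ 'n" where
  "vector_product M \<alpha> N \<beta> X =
     (\<chi> i. signed_product M (\<lambda>A. \<alpha> A $ i) N (\<lambda>B. \<beta> B $ i) X)"

definition lorenz_hull :: "'a measure \<Rightarrow> ('a set \<Rightarrow> real ^ 'n) \<Rightarrow> (real ^ 'n) set" where
  "lorenz_hull M \<mu> = convex hull (\<mu> ` sets M)"

text \<open>
  A definition cannot quantify over types, so the types carrying the underlying measurable
  spaces are parameters. They are arbitrary, hence universally quantified in any theorem.
\<close>

definition is_lorenz_hull :: "'a itself \<Rightarrow> (real ^ 'n) set \<Rightarrow> bool" where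
  "is_lorenz_hull (_ :: 'a itself) H \<longleftrightarrow>
     (\<exists>(M :: 'a measure) \<mu>. signed_vector_measure M \<mu> \<and> H = lorenz_hull M \<mu>)"

text \<open>
  \<open>is_lorenz_product TYPE('a) TYPE('b) H H' P\<close> says that \<open>P\<close> is the product \<open>HH'\<close> computed
  from some representation of \<open>H\<close> over \<open>'a\<close> and some representation of \<open>H'\<close> over \<open>'b\<close>. The
  product is a relation because its independence of the representations (also across
  different types) is a theorem, not part of the definition.
\<close>

definition is_lorenz_product ::
    "'a itself \<Rightarrow> 'b itself \<Rightarrow> (real ^ 'n) set \<Rightarrow> (real ^ 'n) set \<Rightarrow> (real ^ 'n) set \<Rightarrow> bool" where
  "is_lorenz_product (_ :: 'a itself) (_ :: 'b itself) H H' P \<longleftrightarrow>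
     (\<exists>(M :: 'a measure) \<alpha> (N :: 'b measure) \<beta>.
        signed_vector_measure M \<alpha> \<and> signed_vector_measure N \<beta> \<and>
        H = lorenz_hull M \<alpha> \<and> H' = lorenz_hull N \<beta> \<and>
        P = lorenz_hull (M \<Otimes>\<^sub>M N) (vector_product M \<alpha> N \<beta>))"

lemma is_lorenz_product_total:
  assumes "is_lorenz_hull TYPE('a) H" and "is_lorenz_hull TYPE('b) H'"
  shows "\<exists>P. is_lorenz_product TYPE('a) TYPE('b) H H' P"
  using assms unfolding is_lorenz_hull_def is_lorenz_product_def by blast

end

theory Submission
  imports Defs
begin

text \<open>
  A signed vector measure \<open>\<alpha>\<close> is the set integral \<open>A \<mapsto> \<integral>\<^sub>A a d\<kappa>\<close> of a vector-valued density \<open>a\<close>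
  against a finite measure \<open>\<kappa>\<close> (Hahn decomposition and Radon-Nikodym). If \<open>\<beta>\<close> has density \<open>b\<close>
  against \<open>\<eta>\<close>, then \<open>\<alpha> \<times> \<beta>\<close> has the density \<open>a(x) b(y)\<close>, with componentwise product, against
  \<open>\<kappa> \<times> \<eta>\<close>, and by Fubini its value at \<open>E\<close> is \<open>\<integral> \<alpha>(E\<^sub>y) b(y) d\<eta>(y)\<close>, where \<open>E\<^sub>y\<close> is the slice of
  \<open>E\<close> at height \<open>y\<close>. The product is commutative, so it suffices to enlarge one factor at a time:
  if \<open>LH(\<alpha>) \<subseteq> LH(\<gamma>)\<close>, then \<open>LH(\<alpha> \<times> \<beta>) \<subseteq> LH(\<gamma> \<times> \<beta>)\<close>.

  The idea for this inclusion is that the best set for a linear functional can be found fibre by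
  fibre. Let \<open>c\<close> be the density of \<open>\<gamma>\<close> against \<open>\<theta>\<close>. For a vector \<open>u\<close>, the functional
  \<open>u \<bullet> (\<gamma> \<times> \<beta>)(F)\<close> is largest for \<open>F = {(x, y). u \<bullet> (c(x) b(y)) \<ge> 0}\<close>, and each slice \<open>F\<^sub>y\<close> maximises
  \<open>u \<bullet> (\<gamma>(A) b(y))\<close> over all measurable \<open>A\<close>, hence over the hull \<open>LH(\<gamma>)\<close>, to which \<open>\<alpha>(E\<^sub>y)\<close>
  belongs. Integrating over \<open>y\<close> gives \<open>u \<bullet> (\<alpha> \<times> \<beta>)(E) \<le> u \<bullet> (\<gamma> \<times> \<beta>)(F)\<close>.

  With linear functionals alone this places \<open>(\<alpha> \<times> \<beta>)(E)\<close> only in the closure of \<open>LH(\<gamma> \<times> \<beta>)\<close>, and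
  one would have to show that Lorenz hulls are closed. The proof avoids this by comparing vectors
  lexicographically with respect to a list of functionals. A point outside a convex set of
  finite dimension, closed or not, is strictly separated from it by such an order
  (\<open>convex_lex_separation\<close>). The argument above goes through for this order because it is a total
  preorder compatible with the vector space structure and preserved by integration
  (\<open>lex_nonneg_integral\<close>); the resulting \<open>F\<close> contradicts strict separation
  (\<open>product_hull_mono_left\<close>).
\<close>

section \<open>Finite signed measures\<close>

lemma finite_signed_measure_sums:
  assumes "finite_signed_measure M \<mu>" "range A \<subseteq> sets M" "disjoint_family A"
  shows "(\<lambda>k. \<mu> (A k)) sums \<mu> (\<Union>k::nat. A k)"
  using assms unfolding finite_signed_measure_def by blast

lemma finite_signed_measure_empty: "finite_signed_measure M \<mu> \<Longrightarrow> \<mu> {} = 0"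
  unfolding finite_signed_measure_def by blast

lemma finite_signed_measure_Un:
  assumes \<mu>: "finite_signed_measure M \<mu>" and "A \<in> sets M" "B \<in> sets M" "A \<inter> B = {}"
  shows "\<mu> (A \<union> B) = \<mu> A + \<mu> B"
proof -
  have "disjoint_family (binaryset A B)"
    using assms(4) by (auto simp: disjoint_family_on_def binaryset_def)
  then have "(\<lambda>k. \<mu> (binaryset A B k)) sums \<mu> (\<Union>k. binaryset A B k)"
    using assms by (intro finite_signed_measure_sums) (auto simp: range_binaryset_eq)
  moreover have "(\<lambda>k. \<mu> (binaryset A B k)) sums (\<mu> A + \<mu> B)"
    using finite_signed_measure_empty[OF \<mu>] by (rule binaryset_sums)
  ultimately show ?thesis
    by (simp add: UN_binaryset_eq sums_unique2)
qed

lemma finite_signed_measure_Diff: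
  assumes "finite_signed_measure M \<mu>" "A \<in> sets M" "B \<in> sets M" "B \<subseteq> A"
  shows "\<mu> (A - B) = \<mu> A - \<mu> B"
  using finite_signed_measure_Un[of M \<mu> "A - B" B] assms by (simp add: Un_absorb2 Int_commute)

lemma finite_signed_measure_uminus:
  "finite_signed_measure M \<mu> \<Longrightarrow> finite_signed_measure M (\<lambda>A. - \<mu> A)"
  unfolding finite_signed_measure_def by (auto intro: sums_minus)

lemma finite_signed_measure_add:
  assumes "finite_signed_measure M \<mu>" "finite_signed_measure M \<nu>"
  shows "finite_signed_measure M (\<lambda>A. \<mu> A + \<nu> A)"
  using assms unfolding finite_signed_measure_def by (auto intro: sums_add)

lemma finite_signed_measure_sum:
  assumes "\<And>i. i \<in> I \<Longrightarrow> finite_signed_measure M (\<mu> i)"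
  shows "finite_signed_measure M (\<lambda>A. \<Sum>i\<in>I. \<mu> i A)"
  using assms unfolding finite_signed_measure_def by (auto intro: sums_sum)

lemma finite_signed_measure_restrict:
  assumes \<mu>: "finite_signed_measure M \<mu>" and P: "P \<in> sets M"
  shows "finite_signed_measure M (\<lambda>A. \<mu> (A \<inter> P))"
  unfolding finite_signed_measure_def
proof (intro conjI allI impI)
  show "\<mu> ({} \<inter> P) = 0" using finite_signed_measure_empty[OF \<mu>] by simp
next
  fix A :: "nat \<Rightarrow> 'a set" assume "range A \<subseteq> sets M" "disjoint_family A"
  then have "(\<lambda>k. \<mu> (A k \<inter> P)) sums \<mu> (\<Union>k. A k \<inter> P)"
    using P by (intro finite_signed_measure_sums[OF \<mu>]) (auto simp: disjoint_family_on_def)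
  then show "(\<lambda>k. \<mu> (A k \<inter> P)) sums \<mu> ((\<Union>k. A k) \<inter> P)"
    by simp
qed

lemma finite_signed_measure_of_finite_measure:
  assumes "finite_measure \<kappa>" "sets \<kappa> = sets M"
  shows "finite_signed_measure M (measure \<kappa>)"
proof -
  interpret finite_measure \<kappa> by fact
  show ?thesis unfolding finite_signed_measure_def
    using finite_measure_UNION[unfolded assms(2)] by auto
qed

text \<open>
  A signed measure is only a set function, whereas integration needs a value of type
  \<open>'a measure\<close>.
\<close>

lemma finite_measure_of_nonneg_signed_measure:
  assumes \<nu>: "finite_signed_measure M \<nu>" and nn: "\<And>A. A \<in> sets M \<Longrightarrow> 0 \<le> \<nu> A"
  obtains \<kappa> where "finite_measure \<kappa>" "sets \<kappa> = sets M" "\<And>A. A \<in> sets M \<Longrightarrow> measure \<kappa> A = \<nu> A"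
proof -
  define \<kappa> where "\<kappa> = measure_of (space M) (sets M) (\<lambda>A. ennreal (\<nu> A))"
  have sets: "sets \<kappa> = sets M" and space: "space \<kappa> = space M"
    by (simp_all add: \<kappa>_def)
  have "countably_additive (sets M) (\<lambda>A. ennreal (\<nu> A))"
    unfolding countably_additive_def
  proof (intro allI impI)
    fix A :: "nat \<Rightarrow> 'a set" assume A: "range A \<subseteq> sets M" "disjoint_family A"
    then have s: "(\<lambda>k. \<nu> (A k)) sums \<nu> (\<Union>k. A k)"
      by (rule finite_signed_measure_sums[OF \<nu>])
    have "0 \<le> \<nu> (A k)" for k using A nn by auto
    then have "(\<Sum>k. ennreal (\<nu> (A k))) = ennreal (\<nu> (\<Union>k. A k))"
      using s by (simp add: suminf_ennreal2 sums_iff)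
    then show "(\<Sum>k. ennreal (\<nu> (A k))) = ennreal (\<nu> (\<Union> (range A)))" .
  qed
  moreover have "positive (sets M) (\<lambda>A. ennreal (\<nu> A))"
    using finite_signed_measure_empty[OF \<nu>] by (simp add: positive_def)
  ultimately have em: "emeasure \<kappa> A = ennreal (\<nu> A)" if "A \<in> sets M" for A
    unfolding \<kappa>_def using that sets.sigma_algebra_axioms
    by (intro emeasure_measure_of_sigma) auto
  have "finite_measure \<kappa>"
    by (rule finite_measureI) (simp add: em space)
  moreover have "measure \<kappa> A = \<nu> A" if "A \<in> sets M" for A
    using em[OF that] nn[OF that] by (simp add: measure_def)
  ultimately show ?thesis using sets that by blast
qed

section \<open>The Hahn decomposition\<close>

text \<open>
  Sets of nonpositive mass are removed from \<open>A\<close> one after another. The set removed at each stage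
  has mass at most \<open>-1\<close>, or at least half of the negative mass of any subset of what is left (the
  bound \<open>-1\<close> covers the case that these masses are not known to be bounded). The masses removed are summable, hence tend to \<open>0\<close>, so no negative mass can be left. The
  property \<open>K\<close> lets the caller insist on removing sets of a special kind; the Hahn
  decomposition uses this with totally negative sets.
\<close>

lemma finite_signed_measure_exhaustion:
  assumes \<mu>: "finite_signed_measure M \<mu>" and A: "A \<in> sets M"
    and K: "\<And>B. B \<in> sets M \<Longrightarrow> \<mu> B \<le> 0 \<Longrightarrow> \<exists>B'\<in>sets M. B' \<subseteq> B \<and> K B' \<and> \<mu> B' \<le> \<mu> B"
  obtains B :: "nat \<Rightarrow> 'a set" where "range B \<subseteq> sets M" "disjoint_family B" "(\<Union>n. B n) \<subseteq> A"
    "\<And>n. K (B n)" "\<And>n. \<mu> (B n) \<le> 0" "\<And>C. C \<in> sets M \<Longrightarrow> C \<subseteq> A - (\<Union>n. B n) \<Longrightarrow> 0 \<le> \<mu> C"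
proof -
  have greedy: "\<exists>B\<in>sets M. B \<subseteq> X \<and> \<mu> B \<le> 0 \<and>
      (\<forall>C\<in>sets M. C \<subseteq> X \<longrightarrow> \<mu> B \<le> max (\<mu> C / 2) (-1))" if X: "X \<in> sets M" for X
  proof (cases "\<exists>C\<in>sets M. C \<subseteq> X \<and> \<mu> C \<le> -1")
    case True
    then obtain B where "B \<in> sets M" "B \<subseteq> X" "\<mu> B \<le> -1" by blast
    then show ?thesis by (intro bexI[of _ B]) auto
  next
    case False
    define S where "S = \<mu> ` {C \<in> sets M. C \<subseteq> X}"
    have S0: "0 \<in> S"
      unfolding S_def using finite_signed_measure_empty[OF \<mu>] by (intro image_eqI[of _ _ "{}"]) auto
    have bdd: "bdd_below S"
      using False by (intro bdd_belowI[of _ "-1"]) (auto simp: S_def not_le less_imp_le)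
    show ?thesis
    proof (cases "Inf S < 0")
      case True
      then obtain s where "s \<in> S" "s < Inf S / 2"
        using S0 cInf_lessD[of S "Inf S / 2"] by auto
      then obtain B where B: "B \<in> sets M" "B \<subseteq> X" "\<mu> B < Inf S / 2"
        by (auto simp: S_def)
      have "\<mu> B \<le> max (\<mu> C / 2) (-1)" if "C \<in> sets M" "C \<subseteq> X" for C
        using cInf_lower[OF _ bdd, of "\<mu> C"] that B by (auto simp: S_def le_max_iff_disj)
      then show ?thesis using B True by (intro bexI[of _ B]) auto
    next
      case False
      have "0 \<le> \<mu> C" if "C \<in> sets M" "C \<subseteq> X" for C
        using cInf_lower[OF _ bdd, of "\<mu> C"] that False by (auto simp: S_def)
      then show ?thesis
        using finite_signed_measure_empty[OF \<mu>] by (intro bexI[of _ "{}"]) (auto simp: le_max_iff_disj)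
    qed
  qed
  have "\<exists>B\<in>sets M. B \<subseteq> X \<and> K B \<and> \<mu> B \<le> 0 \<and>
      (\<forall>C\<in>sets M. C \<subseteq> X \<longrightarrow> \<mu> B \<le> max (\<mu> C / 2) (-1))" if X: "X \<in> sets M" for X
  proof -
    obtain B where B: "B \<in> sets M" "B \<subseteq> X" "\<mu> B \<le> 0"
      "\<And>C. C \<in> sets M \<Longrightarrow> C \<subseteq> X \<Longrightarrow> \<mu> B \<le> max (\<mu> C / 2) (-1)"
      using greedy[OF X] by blast
    obtain B' where B': "B' \<in> sets M" "B' \<subseteq> B" "K B'" "\<mu> B' \<le> \<mu> B"
      using K[OF B(1) B(3)] by blast
    show ?thesis
      using B' B by (intro bexI[of _ B']) (auto intro: order_trans)
  qed
  then obtain g where g: "\<And>X. X \<in> sets M \<Longrightarrow> g X \<in> sets M \<and> g X \<subseteq> X \<and> K (g X) \<and> \<mu> (g X) \<le> 0 \<and>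
      (\<forall>C\<in>sets M. C \<subseteq> X \<longrightarrow> \<mu> (g X) \<le> max (\<mu> C / 2) (-1))"
    by metis
  \<comment> \<open>\<open>X n\<close> is what is left of \<open>A\<close> after \<open>n\<close> removals.\<close>
  define X where "X = rec_nat A (\<lambda>_ Y. Y - g Y)"
  have X_simps: "X 0 = A" "X (Suc n) = X n - g (X n)" for n
    by (simp_all add: X_def)
  have X: "X n \<in> sets M" for n
    by (induction n) (use A g in \<open>auto simp: X_simps\<close>)
  define B where "B n = g (X n)" for n
  have X_antimono: "X n \<subseteq> X m" if "m \<le> n" for m n
    using that by (induction n rule: dec_induct) (auto simp: X_simps)
  have B: "B n \<in> sets M" "B n \<subseteq> X n" "K (B n)" "\<mu> (B n) \<le> 0"
    "\<And>C. C \<in> sets M \<Longrightarrow> C \<subseteq> X n \<Longrightarrow> \<mu> (B n) \<le> max (\<mu> C / 2) (-1)" for n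
    using g[OF X[of n]] by (auto simp: B_def)
  have "B m \<inter> B n = {}" if "m < n" for m n
    using B(2)[of n] X_antimono[of "Suc m" n] that by (auto simp: X_simps B_def)
  then have disj: "disjoint_family B"
    unfolding disjoint_family_on_def by (metis Int_commute linorder_neqE_nat)
  have sub: "(\<Union>n. B n) \<subseteq> A"
    using B(2) X_antimono[of 0, OF le0] unfolding X_simps by blast
  have rest: "A - (\<Union>n. B n) \<subseteq> X n" for n
    by (induction n) (auto simp: X_simps B_def)
  have "(\<lambda>n. \<mu> (B n)) sums \<mu> (\<Union>n. B n)"
    using B(1) disj by (intro finite_signed_measure_sums[OF \<mu>]) auto
  then have lim: "(\<lambda>n. \<mu> (B n)) \<longlonglongrightarrow> 0"
    by (intro summable_LIMSEQ_zero sums_summable)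
  show ?thesis
  proof (rule that[of B])
    fix C assume C: "C \<in> sets M" "C \<subseteq> A - (\<Union>n. B n)"
    have "\<mu> (B n) \<le> max (\<mu> C / 2) (-1)" for n
      using B(5)[OF C(1)] C(2) rest[of n] by blast
    then have "0 \<le> max (\<mu> C / 2) (-1)"
      by (intro LIMSEQ_le_const2[OF lim] exI[of _ 0]) blast
    then show "0 \<le> \<mu> C" by auto
  qed (use B disj sub in auto)
qed

lemma finite_signed_measure_positive_subset:
  assumes \<mu>: "finite_signed_measure M \<mu>" and A: "A \<in> sets M"
  shows "\<exists>P\<in>sets M. P \<subseteq> A \<and> (\<forall>C\<in>sets M. C \<subseteq> P \<longrightarrow> 0 \<le> \<mu> C) \<and> \<mu> A \<le> \<mu> P"
proof -
  obtain B :: "nat \<Rightarrow> 'a set" where B: "range B \<subseteq> sets M" "disjoint_family B" "(\<Union>n. B n) \<subseteq> A"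
    "\<And>n. \<mu> (B n) \<le> 0" "\<And>C. C \<in> sets M \<Longrightarrow> C \<subseteq> A - (\<Union>n. B n) \<Longrightarrow> 0 \<le> \<mu> C"
    by (rule finite_signed_measure_exhaustion[OF \<mu> A, where K = "\<lambda>_. True"]) auto
  have U: "(\<Union>n. B n) \<in> sets M" using B(1) by auto
  have "\<mu> (\<Union>n. B n) \<le> 0"
    by (rule sums_le[OF B(4) finite_signed_measure_sums[OF \<mu> B(1,2)] sums_zero])
  then have "\<mu> A \<le> \<mu> (A - (\<Union>n. B n))"
    using finite_signed_measure_Diff[OF \<mu> A U B(3)] by simp
  then show ?thesis using A U B(5) by (intro bexI[of _ "A - (\<Union>n. B n)"]) auto
qed

text \<open>
  Every set contains a totally negative set of at most the same mass. Exhausting the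
  whole space by totally negative sets therefore leaves a totally positive set, and the countable
  union of the sets removed is totally negative.
\<close>

theorem Hahn_decomposition:
  assumes \<mu>: "finite_signed_measure M \<mu>"
  obtains P where "P \<in> sets M" "\<And>C. C \<in> sets M \<Longrightarrow> C \<subseteq> P \<Longrightarrow> 0 \<le> \<mu> C"
    "\<And>C. C \<in> sets M \<Longrightarrow> C \<inter> P = {} \<Longrightarrow> \<mu> C \<le> 0"
proof -
  define K where "K N \<longleftrightarrow> (\<forall>C\<in>sets M. C \<subseteq> N \<longrightarrow> \<mu> C \<le> 0)" for N
  have K: "\<exists>B'\<in>sets M. B' \<subseteq> B \<and> K B' \<and> \<mu> B' \<le> \<mu> B" if "B \<in> sets M" for B
    using finite_signed_measure_positive_subset[OF finite_signed_measure_uminus[OF \<mu>] that]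
    by (auto simp: K_def)
  obtain B :: "nat \<Rightarrow> 'a set" where B: "range B \<subseteq> sets M" "disjoint_family B" "\<And>n. K (B n)"
    "\<And>C. C \<in> sets M \<Longrightarrow> C \<subseteq> space M - (\<Union>n. B n) \<Longrightarrow> 0 \<le> \<mu> C"
    by (rule finite_signed_measure_exhaustion[OF \<mu> sets.top, where K = K]) (use K in auto)
  show ?thesis
  proof (rule that[of "space M - (\<Union>n. B n)"])
    show "space M - (\<Union>n. B n) \<in> sets M" using B(1) by auto
  next
    fix C assume C: "C \<in> sets M" "C \<inter> (space M - (\<Union>n. B n)) = {}"
    have "(\<lambda>n. \<mu> (C \<inter> B n)) sums \<mu> (\<Union>n. C \<inter> B n)"
      using B(1,2) C(1)
      by (intro finite_signed_measure_sums[OF \<mu>]) (auto simp: disjoint_family_on_def)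
    moreover have le: "\<mu> (C \<inter> B n) \<le> 0" for n
      using B(1) B(3)[of n] C(1) by (auto simp: K_def)
    moreover have "(\<Union>n. C \<inter> B n) = C"
      using C sets.sets_into_space[OF C(1)] by auto
    ultimately show "\<mu> C \<le> 0"
      using sums_le[OF le _ sums_zero] by simp
  qed (use B in blast)
qed

lemma Jordan_decomposition:
  assumes \<mu>: "finite_signed_measure M \<mu>"
  obtains \<kappa>\<^sub>1 \<kappa>\<^sub>2 where "finite_measure \<kappa>\<^sub>1" "sets \<kappa>\<^sub>1 = sets M" "finite_measure \<kappa>\<^sub>2" "sets \<kappa>\<^sub>2 = sets M"
    "\<And>A. A \<in> sets M \<Longrightarrow> \<mu> A = measure \<kappa>\<^sub>1 A - measure \<kappa>\<^sub>2 A"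
proof -
  obtain P where P: "P \<in> sets M" "\<And>C. C \<in> sets M \<Longrightarrow> C \<subseteq> P \<Longrightarrow> 0 \<le> \<mu> C"
    "\<And>C. C \<in> sets M \<Longrightarrow> C \<inter> P = {} \<Longrightarrow> \<mu> C \<le> 0"
    using Hahn_decomposition[OF \<mu>] by blast
  define N where "N = space M - P"
  have N: "N \<in> sets M" using P by (simp add: N_def)
  obtain \<kappa>\<^sub>1 where \<kappa>1: "finite_measure \<kappa>\<^sub>1" "sets \<kappa>\<^sub>1 = sets M"
      "\<And>A. A \<in> sets M \<Longrightarrow> measure \<kappa>\<^sub>1 A = \<mu> (A \<inter> P)"
    by (rule finite_measure_of_nonneg_signed_measure[OF finite_signed_measure_restrict[OF \<mu> P(1)]])
      (use P in auto)
  obtain \<kappa>\<^sub>2 where \<kappa>2: "finite_measure \<kappa>\<^sub>2" "sets \<kappa>\<^sub>2 = sets M"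
      "\<And>A. A \<in> sets M \<Longrightarrow> measure \<kappa>\<^sub>2 A = - \<mu> (A \<inter> N)"
  proof (rule finite_measure_of_nonneg_signed_measure[OF
        finite_signed_measure_uminus[OF finite_signed_measure_restrict[OF \<mu> N]]])
    show "0 \<le> - \<mu> (A \<inter> N)" if "A \<in> sets M" for A
      using P(3)[of "A \<inter> N"] N that by (auto simp: N_def)
  qed blast
  have "\<mu> A = \<mu> (A \<inter> P) + \<mu> (A \<inter> N)" if A: "A \<in> sets M" for A
  proof -
    have "A = (A \<inter> P) \<union> (A \<inter> N)"
      using sets.sets_into_space[OF A] by (auto simp: N_def)
    moreover have "\<mu> ((A \<inter> P) \<union> (A \<inter> N)) = \<mu> (A \<inter> P) + \<mu> (A \<inter> N)"
      using A P N by (intro finite_signed_measure_Un[OF \<mu>]) (auto simp: N_def)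
    ultimately show ?thesis by simp
  qed
  then show ?thesis using \<kappa>1 \<kappa>2 by (intro that[of \<kappa>\<^sub>1 \<kappa>\<^sub>2]) auto
qed

section \<open>Densities\<close>

lemma finite_measure_has_density:
  assumes "finite_measure \<kappa>" "finite_measure \<nu>" "sets \<nu> = sets \<kappa>"
    and le: "\<And>A. A \<in> sets \<kappa> \<Longrightarrow> measure \<nu> A \<le> measure \<kappa> A"
  obtains f :: "'a \<Rightarrow> real" where "integrable \<kappa> f"
    "\<And>A. A \<in> sets \<kappa> \<Longrightarrow> measure \<nu> A = (LINT x:A|\<kappa>. f x)"
proof -
  interpret \<kappa>: finite_measure \<kappa> by fact
  interpret \<nu>: finite_measure \<nu> by fact
  have ac: "absolutely_continuous \<kappa> \<nu>"
    unfolding absolutely_continuous_def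
  proof
    fix A assume "A \<in> null_sets \<kappa>"
    then have A: "A \<in> sets \<kappa>" "measure \<kappa> A = 0"
      by (auto simp: null_sets_def measure_def)
    then have "measure \<nu> A = 0"
      using le[OF A(1)] measure_nonneg[of \<nu> A] by linarith
    then show "A \<in> null_sets \<nu>"
      using A(1) assms(3) by (simp add: null_sets_def \<nu>.emeasure_eq_measure)
  qed
  obtain D where D: "D \<in> borel_measurable \<kappa>" "AE x in \<kappa>. RN_deriv \<kappa> \<nu> x = ennreal (D x)" "\<And>x. 0 \<le> D x"
    using \<kappa>.real_RN_deriv[OF assms(2) ac assms(3)] by blast
  have "\<nu> = density \<kappa> (RN_deriv \<kappa> \<nu>)"
    using \<kappa>.density_RN_deriv[OF ac assms(3)] by simp
  also have "\<dots> = density \<kappa> (\<lambda>x. ennreal (D x))"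
    using D by (intro density_cong) auto
  finally have \<nu>: "\<nu> = density \<kappa> (\<lambda>x. ennreal (D x))" .
  have "integrable \<nu> (\<lambda>_. 1 :: real)" by simp
  then have int: "integrable \<kappa> D"
    using D by (subst (asm) \<nu>, subst (asm) integrable_density) auto
  moreover have "measure \<nu> A = (LINT x:A|\<kappa>. D x)" if A: "A \<in> sets \<kappa>" for A
  proof -
    have "measure \<nu> A = (LINT x|\<nu>. indicator A x)"
      using A assms(3) sets.sets_into_space[of A \<nu>] by (simp add: Int_absorb2)
    also have "\<dots> = (LINT x|\<kappa>. D x *\<^sub>R indicator A x)"
      using A D by (subst \<nu>, subst integral_density) auto
    finally show ?thesis by (simp add: set_lebesgue_integral_def mult.commute)
  qed
  ultimately show ?thesis by (rule that)
qed

lemma integrable_vec: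
  fixes f :: "'a \<Rightarrow> real ^ 'n"
  assumes "\<And>i. integrable M (\<lambda>x. f x $ i)"
  shows "integrable M f"
proof -
  have "integrable M (\<lambda>x. \<Sum>i\<in>UNIV. (f x $ i) *\<^sub>R axis i 1 :: real ^ 'n)"
    using assms by auto
  then show ?thesis
    by (simp add: basis_expansion flip: scalar_mult_eq_scaleR)
qed

lemma integral_vec_nth:
  fixes f :: "'a \<Rightarrow> real ^ 'n"
  assumes "integrable M f"
  shows "(\<integral>x. f x \<partial>M) $ i = (\<integral>x. f x $ i \<partial>M)"
  using integral_bounded_linear[OF bounded_linear_vec_nth assms] by simp

lemma integrable_indicator_scaleR:
  fixes f :: "'a \<Rightarrow> 'b::{banach, second_countable_topology}"
  assumes "integrable M f" "A \<in> sets M"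
  shows "integrable M (\<lambda>x. indicator A x *\<^sub>R f x)"
  using integrable_mult_indicator[OF assms(2,1)] .

lemma set_lebesgue_integral_vec_nth:
  fixes f :: "'a \<Rightarrow> real ^ 'n"
  assumes "integrable M f" "A \<in> sets M"
  shows "(LINT x:A|M. f x) $ i = (LINT x:A|M. f x $ i)"
  using integral_vec_nth[OF integrable_indicator_scaleR[OF assms]]
  by (simp add: set_lebesgue_integral_def)

text \<open>
  The measure \<open>\<kappa>\<close> is the sum of the positive and negative parts of all components; each part is
  at most \<open>\<kappa>\<close> and so has a density.
\<close>

lemma signed_vector_measure_density:
  assumes \<alpha>: "signed_vector_measure M (\<alpha> :: 'a set \<Rightarrow> real ^ 'n)"
  obtains \<kappa> a where "finite_measure \<kappa>" "sets \<kappa> = sets M" "integrable \<kappa> a"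
    "\<And>A. A \<in> sets M \<Longrightarrow> \<alpha> A = (LINT x:A|\<kappa>. a x)"
proof -
  have "\<exists>\<kappa>\<^sub>1 \<kappa>\<^sub>2. finite_measure \<kappa>\<^sub>1 \<and> sets \<kappa>\<^sub>1 = sets M \<and> finite_measure \<kappa>\<^sub>2 \<and> sets \<kappa>\<^sub>2 = sets M \<and>
      (\<forall>A\<in>sets M. \<alpha> A $ i = measure \<kappa>\<^sub>1 A - measure \<kappa>\<^sub>2 A)" for i
  proof -
    have "finite_signed_measure M (\<lambda>A. \<alpha> A $ i)"
      using \<alpha> by (simp add: signed_vector_measure_def)
    then show ?thesis by (rule Jordan_decomposition) blast
  qed
  then obtain p q where pq: "\<And>i. finite_measure (p i)" "\<And>i. sets (p i) = sets M"
      "\<And>i. finite_measure (q i)" "\<And>i. sets (q i) = sets M"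
      "\<And>i A. A \<in> sets M \<Longrightarrow> \<alpha> A $ i = measure (p i) A - measure (q i) A"
    by metis
  have "finite_signed_measure M (\<lambda>A. (\<Sum>i\<in>UNIV. measure (p i) A) + (\<Sum>i\<in>UNIV. measure (q i) A))"
    by (intro finite_signed_measure_add finite_signed_measure_sum
        finite_signed_measure_of_finite_measure pq)
  then obtain \<kappa> where \<kappa>: "finite_measure \<kappa>" "sets \<kappa> = sets M"
      "\<And>A. A \<in> sets M \<Longrightarrow>
        measure \<kappa> A = (\<Sum>i\<in>UNIV. measure (p i) A) + (\<Sum>i\<in>UNIV. measure (q i) A)"
    by (rule finite_measure_of_nonneg_signed_measure) (auto intro!: add_nonneg_nonneg sum_nonneg)
  have p_le: "measure (p i) A \<le> measure \<kappa> A" and q_le: "measure (q i) A \<le> measure \<kappa> A"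
    if "A \<in> sets \<kappa>" for i A
    using member_le_sum[of i UNIV "\<lambda>i. measure (p i) A"] member_le_sum[of i UNIV "\<lambda>i. measure (q i) A"]
      sum_nonneg[of UNIV "\<lambda>i. measure (p i) A"] sum_nonneg[of UNIV "\<lambda>i. measure (q i) A"] that \<kappa>
    by auto
  have "\<exists>f. integrable \<kappa> f \<and> (\<forall>A\<in>sets \<kappa>. measure (p i) A = (LINT x:A|\<kappa>. f x))" for i
    by (rule finite_measure_has_density[OF \<kappa>(1) pq(1)[of i] _ p_le]) (use pq \<kappa> in auto)
  then obtain f where f: "\<And>i. integrable \<kappa> (f i)"
      "\<And>i A. A \<in> sets \<kappa> \<Longrightarrow> measure (p i) A = (LINT x:A|\<kappa>. f i x)"
    by metis
  have "\<exists>f. integrable \<kappa> f \<and> (\<forall>A\<in>sets \<kappa>. measure (q i) A = (LINT x:A|\<kappa>. f x))" for i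
    by (rule finite_measure_has_density[OF \<kappa>(1) pq(3)[of i] _ q_le]) (use pq \<kappa> in auto)
  then obtain g where g: "\<And>i. integrable \<kappa> (g i)"
      "\<And>i A. A \<in> sets \<kappa> \<Longrightarrow> measure (q i) A = (LINT x:A|\<kappa>. g i x)"
    by metis
  define a where "a x = (\<chi> i. f i x - g i x)" for x
  have a: "integrable \<kappa> a"
    using f(1) g(1) by (intro integrable_vec) (simp add: a_def)
  have "\<alpha> A = (LINT x:A|\<kappa>. a x)" if A: "A \<in> sets M" for A
  proof (subst vec_eq_iff, intro allI)
    fix i
    have "\<alpha> A $ i = (LINT x:A|\<kappa>. f i x) - (LINT x:A|\<kappa>. g i x)"
      using pq(5)[OF A] f(2) g(2) \<kappa>(2) A by simp
    also have "\<dots> = (LINT x:A|\<kappa>. a x $ i)"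
      unfolding a_def vec_lambda_beta using f(1) g(1) A \<kappa>(2)
      by (intro set_integral_diff(2)[symmetric])
        (simp_all only: set_integrable_def integrable_indicator_scaleR)
    also have "\<dots> = (LINT x:A|\<kappa>. a x) $ i"
      using set_lebesgue_integral_vec_nth[OF a] A \<kappa>(2) by simp
    finally show "\<alpha> A $ i = (LINT x:A|\<kappa>. a x) $ i" .
  qed
  with \<kappa>(1,2) a show ?thesis by (rule that)
qed

lemma finite_signed_measure_set_integral:
  fixes f :: "'a \<Rightarrow> real"
  assumes f: "integrable M f"
  shows "finite_signed_measure M (\<lambda>A. LINT x:A|M. f x)"
  unfolding finite_signed_measure_def
proof (intro conjI allI impI)
  show "(LINT x:{}|M. f x) = 0" by (simp add: set_lebesgue_integral_def)
next
  fix A :: "nat \<Rightarrow> 'a set" assume A: "range A \<subseteq> sets M" "disjoint_family A"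
  have si: "set_integrable M B f" if "B \<in> sets M" for B
    using integrable_indicator_scaleR[OF f that] by (simp add: set_integrable_def)
  have "(\<lambda>n. LINT x:(\<Union>i<n. A i)|M. f x) \<longlonglongrightarrow> (LINT x:(\<Union>n. \<Union>i<n. A i)|M. f x)"
    using A by (intro set_integral_cont_up si) (auto intro!: incseq_SucI simp: less_Suc_eq)
  moreover have "(\<Union>n. \<Union>i<n. A i) = (\<Union>i. A i)" by auto
  moreover have "(LINT x:(\<Union>i<n. A i)|M. f x) = (\<Sum>i<n. LINT x:A i|M. f x)" for n
    using A by (intro set_integral_finite_Union) (auto intro!: si simp: disjoint_family_on_def)
  ultimately show "(\<lambda>k. LINT x:A k|M. f x) sums (LINT x:(\<Union>k. A k)|M. f x)"
    by (simp add: sums_def)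
qed

section \<open>Product measures through densities\<close>

lemma integral_product_functions:
  fixes f :: "'a \<Rightarrow> real" and g :: "'b \<Rightarrow> real"
  assumes "finite_measure \<kappa>" "finite_measure \<eta>" and f: "integrable \<kappa> f" and g: "integrable \<eta> g"
  shows integrable_product_functions: "integrable (\<kappa> \<Otimes>\<^sub>M \<eta>) (\<lambda>z. f (fst z) * g (snd z))"
    and "(\<integral>z. f (fst z) * g (snd z) \<partial>(\<kappa> \<Otimes>\<^sub>M \<eta>)) = (\<integral>x. f x \<partial>\<kappa>) * (\<integral>y. g y \<partial>\<eta>)"
proof -
  interpret \<kappa>: finite_measure \<kappa> by fact
  interpret \<eta>: finite_measure \<eta> by fact
  interpret pair_sigma_finite \<kappa> \<eta> by unfold_locales
  have [measurable]: "f \<in> borel_measurable \<kappa>" "g \<in> borel_measurable \<eta>"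
    using f g by auto
  show int: "integrable (\<kappa> \<Otimes>\<^sub>M \<eta>) (\<lambda>z. f (fst z) * g (snd z))"
    using f g by (intro Fubini_integrable) (auto simp: abs_mult)
  have "(\<integral>x. (\<integral>y. f x * g y \<partial>\<eta>) \<partial>\<kappa>) = (\<integral>z. f (fst z) * g (snd z) \<partial>(\<kappa> \<Otimes>\<^sub>M \<eta>))"
    using integral_fst[of "\<lambda>x y. f x * g y"] int by (simp add: case_prod_beta')
  then show "(\<integral>z. f (fst z) * g (snd z) \<partial>(\<kappa> \<Otimes>\<^sub>M \<eta>)) = (\<integral>x. f x \<partial>\<kappa>) * (\<integral>y. g y \<partial>\<eta>)"
    using f g by simp
qed

text \<open>
  The rectangles are closed under intersection and generate the product sigma-algebra, and the
  sets on which two finite signed measures agree form a Dynkin system.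
\<close>

lemma finite_signed_measure_pair_eqI:
  assumes \<rho>: "finite_signed_measure (M \<Otimes>\<^sub>M N) \<rho>" and \<sigma>: "finite_signed_measure (M \<Otimes>\<^sub>M N) \<sigma>"
    and eq: "\<And>A B. A \<in> sets M \<Longrightarrow> B \<in> sets N \<Longrightarrow> \<rho> (A \<times> B) = \<sigma> (A \<times> B)"
    and X: "X \<in> sets (M \<Otimes>\<^sub>M N)"
  shows "\<rho> X = \<sigma> X"
  using Int_stable_pair_measure_generator pair_measure_closed[of M N] X[unfolded sets_pair_measure]
proof (induction X rule: sigma_sets_induct_disjoint)
  case (basic A)
  then show ?case using eq by auto
next
  case empty
  then show ?case using \<rho> \<sigma> by (simp add: finite_signed_measure_empty)
next
  case (compl A)
  have top: "space M \<times> space N \<in> sets (M \<Otimes>\<^sub>M N)" by auto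
  have A: "A \<in> sets (M \<Otimes>\<^sub>M N)" using compl by (simp add: sets_pair_measure)
  then have sub: "A \<subseteq> space M \<times> space N"
    using sets.sets_into_space by (fastforce simp: space_pair_measure)
  show ?case
    using finite_signed_measure_Diff[OF \<rho> top A sub] finite_signed_measure_Diff[OF \<sigma> top A sub]
      eq[of "space M" "space N"] compl by simp
next
  case (union A)
  have A: "range A \<subseteq> sets (M \<Otimes>\<^sub>M N)" using union by (simp add: sets_pair_measure)
  show ?case
    using finite_signed_measure_sums[OF \<rho> A union(1)] finite_signed_measure_sums[OF \<sigma> A union(1)]
      union(3) by (simp add: sums_unique2)
qed

text \<open>
  This shows that the definite description defining \<^const>\<open>signed_product\<close> denotes: the set
  integral is a candidate by Fubini, and it is the only one by uniqueness on rectangles.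
\<close>

lemma signed_product_eq_set_integral:
  fixes f :: "'a \<Rightarrow> real" and g :: "'b \<Rightarrow> real"
  assumes fin: "finite_measure \<kappa>" "finite_measure \<eta>"
    and sets: "sets \<kappa> = sets M" "sets \<eta> = sets N"
    and f: "integrable \<kappa> f" and g: "integrable \<eta> g"
    and \<mu>: "\<And>A. A \<in> sets M \<Longrightarrow> \<mu> A = (LINT x:A|\<kappa>. f x)"
    and \<nu>: "\<And>B. B \<in> sets N \<Longrightarrow> \<nu> B = (LINT y:B|\<eta>. g y)"
    and X: "X \<in> sets (M \<Otimes>\<^sub>M N)"
  shows "signed_product M \<mu> N \<nu> X = (LINT z:X|\<kappa> \<Otimes>\<^sub>M \<eta>. f (fst z) * g (snd z))"
proof -
  let ?P = "\<lambda>\<rho>. finite_signed_measure (M \<Otimes>\<^sub>M N) \<rho> \<and>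
      (\<forall>A\<in>sets M. \<forall>B\<in>sets N. \<rho> (A \<times> B) = \<mu> A * \<nu> B) \<and> \<rho> \<in> extensional (sets (M \<Otimes>\<^sub>M N))"
  define I where "I X = (LINT z:X|\<kappa> \<Otimes>\<^sub>M \<eta>. f (fst z) * g (snd z))" for X
  define R where "R = restrict I (sets (M \<Otimes>\<^sub>M N))"
  have sets_pair: "sets (\<kappa> \<Otimes>\<^sub>M \<eta>) = sets (M \<Otimes>\<^sub>M N)"
    using sets by (rule sets_pair_measure_cong)
  have "finite_signed_measure (\<kappa> \<Otimes>\<^sub>M \<eta>) I"
    unfolding I_def
    by (intro finite_signed_measure_set_integral integrable_product_functions fin f g)
  then have I: "finite_signed_measure (M \<Otimes>\<^sub>M N) I"
    by (simp add: finite_signed_measure_def sets_pair)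
  have "finite_signed_measure (M \<Otimes>\<^sub>M N) R"
    unfolding finite_signed_measure_def
  proof (intro conjI allI impI)
    show "R {} = 0" using finite_signed_measure_empty[OF I] by (simp add: R_def)
  next
    fix A :: "nat \<Rightarrow> ('a \<times> 'b) set" assume A: "range A \<subseteq> sets (M \<Otimes>\<^sub>M N)" "disjoint_family A"
    then have "A k \<in> sets (M \<Otimes>\<^sub>M N)" "(\<Union>k. A k) \<in> sets (M \<Otimes>\<^sub>M N)" for k
      by auto
    then show "(\<lambda>k. R (A k)) sums R (\<Union>k. A k)"
      using finite_signed_measure_sums[OF I A] by (simp add: R_def)
  qed
  moreover have "R (A \<times> B) = \<mu> A * \<nu> B" if A: "A \<in> sets M" and B: "B \<in> sets N" for A B
  proof -
    have "I (A \<times> B) = (\<integral>z. (indicator A (fst z) * f (fst z)) * (indicator B (snd z) * g (snd z)) \<partial>(\<kappa> \<Otimes>\<^sub>M \<eta>))"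
      by (simp add: I_def set_lebesgue_integral_def indicator_times mult_ac)
    also have "\<dots> = \<mu> A * \<nu> B"
      using A B sets integrable_indicator_scaleR[OF f, of A] integrable_indicator_scaleR[OF g, of B]
      by (subst integral_product_functions[OF fin])
        (simp_all add: \<mu>[OF A] \<nu>[OF B] set_lebesgue_integral_def)
    finally show ?thesis using A B by (simp add: R_def)
  qed
  ultimately have R: "?P R" by (auto simp: R_def)
  have unique: "\<rho> = R" if \<rho>: "?P \<rho>" for \<rho>
  proof (rule extensionalityI[of _ "sets (M \<Otimes>\<^sub>M N)"])
    show "\<rho> Y = R Y" if "Y \<in> sets (M \<Otimes>\<^sub>M N)" for Y
      using finite_signed_measure_pair_eqI[of M N \<rho> R Y] \<rho> R that by simp
  qed (use \<rho> R in auto)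
  have "signed_product M \<mu> N \<nu> = R"
    unfolding signed_product_def using R unique by (rule the_equality)
  then show ?thesis using X by (simp add: R_def I_def)
qed

lemma integrable_product_vec:
  fixes a :: "'a \<Rightarrow> real ^ 'n" and b :: "'b \<Rightarrow> real ^ 'n"
  assumes "finite_measure \<kappa>" "finite_measure \<eta>" "integrable \<kappa> a" "integrable \<eta> b"
  shows "integrable (\<kappa> \<Otimes>\<^sub>M \<eta>) (\<lambda>z. a (fst z) * b (snd z))"
  using assms
  by (intro integrable_vec)
    (auto intro!: integrable_product_functions integrable_bounded_linear[OF bounded_linear_vec_nth])

lemma vector_product_eq_set_integral:
  fixes a :: "'a \<Rightarrow> real ^ 'n" and b :: "'b \<Rightarrow> real ^ 'n"
  assumes fin: "finite_measure \<kappa>" "finite_measure \<eta>"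
    and sets: "sets \<kappa> = sets M" "sets \<eta> = sets N"
    and a: "integrable \<kappa> a" and b: "integrable \<eta> b"
    and \<alpha>: "\<And>A. A \<in> sets M \<Longrightarrow> \<alpha> A = (LINT x:A|\<kappa>. a x)"
    and \<beta>: "\<And>B. B \<in> sets N \<Longrightarrow> \<beta> B = (LINT y:B|\<eta>. b y)"
    and X: "X \<in> sets (M \<Otimes>\<^sub>M N)"
  shows "vector_product M \<alpha> N \<beta> X = (LINT z:X|\<kappa> \<Otimes>\<^sub>M \<eta>. a (fst z) * b (snd z))"
proof (subst vec_eq_iff, intro allI)
  fix i
  have sets_pair: "sets (\<kappa> \<Otimes>\<^sub>M \<eta>) = sets (M \<Otimes>\<^sub>M N)"
    using sets by (rule sets_pair_measure_cong)
  have "vector_product M \<alpha> N \<beta> X $ i = (LINT z:X|\<kappa> \<Otimes>\<^sub>M \<eta>. a (fst z) $ i * b (snd z) $ i)"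
    unfolding vector_product_def vec_lambda_beta
    using sets \<alpha> \<beta> X a b
    by (intro signed_product_eq_set_integral fin)
      (auto simp: set_lebesgue_integral_vec_nth intro: integrable_bounded_linear[OF bounded_linear_vec_nth])
  also have "\<dots> = (LINT z:X|\<kappa> \<Otimes>\<^sub>M \<eta>. a (fst z) * b (snd z)) $ i"
    using set_lebesgue_integral_vec_nth[OF integrable_product_vec[OF fin a b], of X i] X sets_pair
    by simp
  finally show "vector_product M \<alpha> N \<beta> X $ i = (LINT z:X|\<kappa> \<Otimes>\<^sub>M \<eta>. a (fst z) * b (snd z)) $ i" .
qed

section \<open>Lexicographic separation\<close>

text \<open>
  The vector \<open>x\<close> is at least \<open>0\<close> when the sequence of its values under the functionals \<open>us\<close> is
  so lexicographically. Strict negativity is written \<open>\<not> lex_nonneg us x\<close>, since this preorder is total.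
\<close>

primrec lex_nonneg :: "'a::euclidean_space list \<Rightarrow> 'a \<Rightarrow> bool" where
  "lex_nonneg [] x \<longleftrightarrow> True"
| "lex_nonneg (u # us) x \<longleftrightarrow> 0 < u \<bullet> x \<or> u \<bullet> x = 0 \<and> lex_nonneg us x"

lemma lex_nonneg_add: "lex_nonneg us x \<Longrightarrow> lex_nonneg us y \<Longrightarrow> lex_nonneg us (x + y)"
  by (induction us) (auto simp: inner_add_right)

lemma lex_nonneg_zero: "lex_nonneg us 0"
  by (induction us) auto

lemma lex_nonneg_scaleR:
  assumes "lex_nonneg us x" "0 \<le> r"
  shows "lex_nonneg us (r *\<^sub>R x)"
proof (cases "r = 0")
  case False
  then show ?thesis using assms by (induction us) auto
qed (simp add: lex_nonneg_zero)

lemma lex_nonneg_total: "\<not> lex_nonneg us x \<Longrightarrow> lex_nonneg us (- x)"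
  by (induction us) auto

text \<open>
  A supporting hyperplane at \<open>0\<close> separates weakly. The points of \<open>C\<close> that it fails to separate
  strictly lie in the hyperplane; they form a convex set of smaller dimension, to which the
  induction hypothesis supplies the remaining functionals.
\<close>

lemma convex_lex_separation:
  fixes C :: "'a::euclidean_space set"
  assumes "convex C" "0 \<notin> C"
  shows "\<exists>us. \<forall>x\<in>C. \<not> lex_nonneg us x"
  using assms
proof (induction "dim C" arbitrary: C rule: less_induct)
  case less
  show ?case
  proof (cases "C = {}")
    case False
    obtain a where a: "a \<in> span C" "a \<noteq> 0" "\<And>x. x \<in> C \<Longrightarrow> 0 \<le> a \<bullet> x"
      using separating_hyperplane_set_0_inspan[OF less.prems(1) False less.prems(2)] by blast
    define F where "F = C \<inter> {x. a \<bullet> x = 0}"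
    have "span F \<subseteq> span C \<inter> {x. a \<bullet> x = 0}"
      by (intro span_minimal subspace_inter subspace_span subspace_hyperplane)
        (auto simp: F_def intro: span_base)
    then have "span F \<subset> span C"
      \<comment> \<open>The inclusion is proper because \<open>a\<close> is in \<open>span C\<close> but not orthogonal to itself.\<close>
      using a(1,2) by auto
    then have "dim F < dim C" by (rule dim_psubset)
    moreover have "convex F"
      unfolding F_def by (intro convex_Int less.prems convex_hyperplane)
    moreover have "0 \<notin> F" using less.prems by (simp add: F_def)
    ultimately obtain us where us: "\<forall>x\<in>F. \<not> lex_nonneg us x"
      using less.hyps by blast
    have "\<not> lex_nonneg (- a # us) x" if "x \<in> C" for x
      using us a(3)[OF that] that by (auto simp: F_def)
    then show ?thesis by blast
  qed simp
qed

text \<open>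
  The first coordinate of the integral is nonnegative; if it vanishes, then the first coordinate
  of the integrand vanishes almost everywhere, and the next functional decides. This is why the
  induction needs the hypothesis in its almost everywhere form.
\<close>

lemma lex_nonneg_integral_AE:
  fixes f :: "'a \<Rightarrow> 'b::euclidean_space"
  assumes f: "integrable M f" and nn: "AE x in M. lex_nonneg us (f x)"
  shows "lex_nonneg us (\<integral>x. f x \<partial>M)"
  using nn
proof (induction us)
  case (Cons u us)
  have eq: "u \<bullet> (\<integral>x. f x \<partial>M) = (\<integral>x. u \<bullet> f x \<partial>M)" and int: "integrable M (\<lambda>x. u \<bullet> f x)"
    using f by auto
  have nn: "AE x in M. 0 \<le> u \<bullet> f x"
    using Cons.prems by (rule eventually_mono) auto
  show ?case
  proof (cases "(\<integral>x. u \<bullet> f x \<partial>M) = 0")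
    case True
    then have "AE x in M. u \<bullet> f x = 0"
      using integral_nonneg_eq_0_iff_AE[OF int nn] by simp
    then have "AE x in M. lex_nonneg us (f x)"
      using Cons.prems by eventually_elim auto
    then show ?thesis using Cons.IH True eq by simp
  next
    case False
    then show ?thesis using integral_nonneg_AE[OF nn] eq by simp
  qed
qed simp

lemma lex_nonneg_integral:
  fixes f :: "'a \<Rightarrow> 'b::euclidean_space"
  assumes "integrable M f" "\<And>x. x \<in> space M \<Longrightarrow> lex_nonneg us (f x)"
  shows "lex_nonneg us (\<integral>x. f x \<partial>M)"
  using assms by (intro lex_nonneg_integral_AE) auto

lemma pred_lex_nonneg [measurable]:
  fixes f :: "'a \<Rightarrow> 'b::euclidean_space"
  assumes [measurable]: "f \<in> borel_measurable M"
  shows "Measurable.pred M (\<lambda>x. lex_nonneg us (f x))"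
  by (induction us) simp_all

section \<open>Monotonicity in one factor\<close>

lemma sets_horizontal_slice:
  assumes "E \<in> sets (\<kappa> \<Otimes>\<^sub>M \<eta>)"
  shows "{x. (x, y) \<in> E} \<in> sets \<kappa>"
  using sets_Pair2[OF assms, of y] by (simp add: vimage_def)

lemma set_integral_product_slices:
  fixes a :: "'a \<Rightarrow> real ^ 'n" and b :: "'b \<Rightarrow> real ^ 'n"
  assumes fin: "finite_measure \<kappa>" "finite_measure \<eta>"
    and a: "integrable \<kappa> a" and b: "integrable \<eta> b" and E: "E \<in> sets (\<kappa> \<Otimes>\<^sub>M \<eta>)"
  shows integrable_slices: "integrable \<eta> (\<lambda>y. (LINT x:{x. (x, y) \<in> E}|\<kappa>. a x) * b y)"
    and "(LINT z:E|\<kappa> \<Otimes>\<^sub>M \<eta>. a (fst z) * b (snd z)) =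
      (\<integral>y. (LINT x:{x. (x, y) \<in> E}|\<kappa>. a x) * b y \<partial>\<eta>)"
proof -
  interpret \<kappa>: finite_measure \<kappa> by fact
  interpret \<eta>: finite_measure \<eta> by fact
  interpret pair_sigma_finite \<kappa> \<eta> by unfold_locales
  let ?f = "\<lambda>x y. indicator E (x, y) *\<^sub>R (a x * b y)"
  have int: "integrable (\<kappa> \<Otimes>\<^sub>M \<eta>) (\<lambda>(x, y). ?f x y)"
    using integrable_indicator_scaleR[OF integrable_product_vec[OF fin a b] E]
    by (simp add: case_prod_beta')
  have slice: "(\<integral>x. ?f x y \<partial>\<kappa>) = (LINT x:{x. (x, y) \<in> E}|\<kappa>. a x) * b y" for y
  proof -
    have "bounded_linear (\<lambda>v. v * b y)"
      by (intro linear_conv_bounded_linear[THEN iffD1] linearI) (simp_all add: distrib_right)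
    from integral_bounded_linear[OF this integrable_indicator_scaleR[OF a sets_horizontal_slice[OF E, of y]]]
    show ?thesis by (simp add: set_lebesgue_integral_def indicator_def)
  qed
  show "integrable \<eta> (\<lambda>y. (LINT x:{x. (x, y) \<in> E}|\<kappa>. a x) * b y)"
    using integrable_snd[OF int] by (simp only: slice)
  show "(LINT z:E|\<kappa> \<Otimes>\<^sub>M \<eta>. a (fst z) * b (snd z)) =
      (\<integral>y. (LINT x:{x. (x, y) \<in> E}|\<kappa>. a x) * b y \<partial>\<eta>)"
    using integral_snd[OF int] by (simp add: slice set_lebesgue_integral_def case_prod_beta')
qed

text \<open>
  Where \<open>f\<close> is nonnegative, passing from \<open>A\<close> to \<open>B\<close> can only add \<open>f\<close>; elsewhere it can only
  remove a negative value. So \<open>B\<close> maximises the set integral of \<open>f\<close>.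
\<close>

lemma lex_nonneg_best_set:
  fixes f :: "'a \<Rightarrow> 'b::euclidean_space"
  assumes f: "integrable M f" and A: "A \<in> sets M" and B: "B \<in> sets M"
    and B_iff: "\<And>x. x \<in> space M \<Longrightarrow> x \<in> B \<longleftrightarrow> lex_nonneg us (f x)"
  shows "lex_nonneg us ((LINT x:B|M. f x) - (LINT x:A|M. f x))"
proof -
  note int = integrable_indicator_scaleR[OF f A] integrable_indicator_scaleR[OF f B]
  have "lex_nonneg us (\<integral>x. indicator B x *\<^sub>R f x - indicator A x *\<^sub>R f x \<partial>M)"
  proof (rule lex_nonneg_integral)
    fix x assume "x \<in> space M"
    then show "lex_nonneg us (indicator B x *\<^sub>R f x - indicator A x *\<^sub>R f x)"
      using B_iff[of x] lex_nonneg_total[of us "f x"] lex_nonneg_zero[of us]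
      by (cases "x \<in> A"; cases "x \<in> B") auto
  qed (use int in auto)
  then show ?thesis using int by (simp add: set_lebesgue_integral_def)
qed

text \<open>
  If a value \<open>p\<close> of the smaller product were outside the larger hull, a lexicographic order would
  put it strictly above the whole hull. The set \<open>F\<close> that is optimal for this order has optimal
  slices, so its value \<open>q\<close> is at least \<open>p\<close> after integration over the slices, although \<open>q\<close>
  is in the hull.
\<close>

lemma product_hull_mono_left:
  fixes a :: "'a \<Rightarrow> real ^ 'n" and b :: "'b \<Rightarrow> real ^ 'n" and c :: "'c \<Rightarrow> real ^ 'n"
  assumes fin: "finite_measure \<kappa>" "finite_measure \<eta>" "finite_measure \<theta>"
    and a: "integrable \<kappa> a" and b: "integrable \<eta> b" and c: "integrable \<theta> c"
    and sub: "lorenz_hull \<kappa> (\<lambda>A. LINT x:A|\<kappa>. a x) \<subseteq> lorenz_hull \<theta> (\<lambda>A. LINT x:A|\<theta>. c x)"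
  shows "lorenz_hull (\<kappa> \<Otimes>\<^sub>M \<eta>) (\<lambda>E. LINT z:E|\<kappa> \<Otimes>\<^sub>M \<eta>. a (fst z) * b (snd z))
    \<subseteq> lorenz_hull (\<theta> \<Otimes>\<^sub>M \<eta>) (\<lambda>E. LINT z:E|\<theta> \<Otimes>\<^sub>M \<eta>. c (fst z) * b (snd z))"
    (is "_ \<subseteq> ?Q")
proof -
  have "(LINT z:E|\<kappa> \<Otimes>\<^sub>M \<eta>. a (fst z) * b (snd z)) \<in> ?Q" if E: "E \<in> sets (\<kappa> \<Otimes>\<^sub>M \<eta>)" for E
  proof (rule ccontr)
    define p where "p = (LINT z:E|\<kappa> \<Otimes>\<^sub>M \<eta>. a (fst z) * b (snd z))"
    assume "\<not> ?thesis"
    then have "p \<notin> ?Q" by (simp add: p_def)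
    then have "0 \<notin> (\<lambda>q. q - p) ` ?Q" by auto
    moreover have "convex ((\<lambda>q. q - p) ` ?Q)"
      by (simp add: lorenz_hull_def convex_translation_subtract)
    ultimately obtain us where us: "\<And>q. q \<in> ?Q \<Longrightarrow> \<not> lex_nonneg us (q - p)"
      using convex_lex_separation[of "(\<lambda>q. q - p) ` ?Q"] by auto
    have [measurable]: "(\<lambda>z. c (fst z) * b (snd z)) \<in> borel_measurable (\<theta> \<Otimes>\<^sub>M \<eta>)"
      using integrable_product_vec[OF fin(3,2) c b] by simp
    define F where "F = {z \<in> space (\<theta> \<Otimes>\<^sub>M \<eta>). lex_nonneg us (c (fst z) * b (snd z))}"
    have F: "F \<in> sets (\<theta> \<Otimes>\<^sub>M \<eta>)"
      unfolding F_def by measurable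
    define q where "q = (LINT z:F|\<theta> \<Otimes>\<^sub>M \<eta>. c (fst z) * b (snd z))"
    define \<alpha> where "\<alpha> A = (LINT x:A|\<kappa>. a x)" for A
    define \<gamma> where "\<gamma> A = (LINT x:A|\<theta>. c x)" for A
    have slice: "lex_nonneg us (\<gamma> {x. (x, y) \<in> F} * b y - \<alpha> {x. (x, y) \<in> E} * b y)"
      if y: "y \<in> space \<eta>" for y
    proof -
      let ?g = "\<gamma> {x. (x, y) \<in> F}"
      \<comment> \<open>The vectors that \<open>?g\<close> dominates in the order seen from height \<open>y\<close>: a convex set
        containing the range of \<open>\<gamma>\<close>, hence all of \<open>LH(\<gamma>)\<close>.\<close>
      let ?K = "{v. lex_nonneg us (?g * b y - v * b y)}"
      have bl: "bounded_linear (\<lambda>v. v * b y)"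
        by (intro linear_conv_bounded_linear[THEN iffD1] linearI) (simp_all add: distrib_right)
      have \<gamma>: "\<gamma> A * b y = (LINT x:A|\<theta>. c x * b y)" if "A \<in> sets \<theta>" for A
        using integral_bounded_linear[OF bl integrable_indicator_scaleR[OF c that]]
        by (simp add: \<gamma>_def set_lebesgue_integral_def)
      have "\<gamma> A \<in> ?K" if A: "A \<in> sets \<theta>" for A
      proof -
        have "lex_nonneg us ((LINT x:{x. (x, y) \<in> F}|\<theta>. c x * b y) - (LINT x:A|\<theta>. c x * b y))"
          using y by (intro lex_nonneg_best_set integrable_bounded_linear[OF bl c] A
              sets_horizontal_slice[OF F]) (simp add: F_def space_pair_measure)
        then show ?thesis by (simp add: \<gamma> A sets_horizontal_slice[OF F])
      qed
      moreover have "convex ?K"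
      proof (rule convexI, unfold mem_Collect_eq)
        fix v w :: "real ^ 'n" and r s :: real
        assume vw: "lex_nonneg us (?g * b y - v * b y)" "lex_nonneg us (?g * b y - w * b y)"
          and rs: "0 \<le> r" "0 \<le> s" "r + s = 1"
        have "r *\<^sub>R (?g * b y - v * b y) + s *\<^sub>R (?g * b y - w * b y) =
            (r + s) *\<^sub>R (?g * b y) - (r *\<^sub>R v + s *\<^sub>R w) * b y"
          by (simp add: algebra_simps)
        with lex_nonneg_add[OF lex_nonneg_scaleR[OF vw(1) rs(1)] lex_nonneg_scaleR[OF vw(2) rs(2)]]
        show "lex_nonneg us (?g * b y - (r *\<^sub>R v + s *\<^sub>R w) * b y)"
          by (simp add: rs(3))
      qed
      ultimately have "lorenz_hull \<theta> \<gamma> \<subseteq> ?K"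
        unfolding lorenz_hull_def by (intro hull_minimal) auto
      moreover have "\<alpha> {x. (x, y) \<in> E} \<in> lorenz_hull \<kappa> \<alpha>"
        unfolding lorenz_hull_def using sets_horizontal_slice[OF E] by (intro hull_inc imageI)
      ultimately show ?thesis
        using sub unfolding \<alpha>_def[abs_def, symmetric] \<gamma>_def[abs_def, symmetric] by blast
    qed
    have "q - p = (\<integral>y. \<gamma> {x. (x, y) \<in> F} * b y - \<alpha> {x. (x, y) \<in> E} * b y \<partial>\<eta>)"
      and int: "integrable \<eta> (\<lambda>y. \<gamma> {x. (x, y) \<in> F} * b y - \<alpha> {x. (x, y) \<in> E} * b y)"
      using integrable_slices[OF fin(1,2) a b E] integrable_slices[OF fin(3,2) c b F]
      unfolding p_def q_def \<alpha>_def \<gamma>_def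
      by (auto simp: set_integral_product_slices[OF fin(1,2) a b E]
          set_integral_product_slices[OF fin(3,2) c b F])
    moreover have "lex_nonneg us (\<integral>y. \<gamma> {x. (x, y) \<in> F} * b y - \<alpha> {x. (x, y) \<in> E} * b y \<partial>\<eta>)"
      using int slice by (rule lex_nonneg_integral)
    ultimately have "lex_nonneg us (q - p)" by simp
    moreover have "q \<in> ?Q"
      unfolding q_def lorenz_hull_def using F by (intro hull_inc imageI)
    ultimately show False using us by blast
  qed
  then show ?thesis
    by (subst lorenz_hull_def, intro hull_minimal) (auto simp: lorenz_hull_def)
qed

lemma product_hull_swap_subset:
  fixes a :: "'a \<Rightarrow> real ^ 'n" and b :: "'b \<Rightarrow> real ^ 'n"
  assumes fin: "finite_measure \<kappa>" "finite_measure \<eta>" and a: "integrable \<kappa> a" and b: "integrable \<eta> b"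
  shows "lorenz_hull (\<kappa> \<Otimes>\<^sub>M \<eta>) (\<lambda>E. LINT z:E|\<kappa> \<Otimes>\<^sub>M \<eta>. a (fst z) * b (snd z))
    \<subseteq> lorenz_hull (\<eta> \<Otimes>\<^sub>M \<kappa>) (\<lambda>E. LINT z:E|\<eta> \<Otimes>\<^sub>M \<kappa>. b (fst z) * a (snd z))"
proof -
  interpret \<kappa>: finite_measure \<kappa> by fact
  interpret \<eta>: finite_measure \<eta> by fact
  interpret pair_sigma_finite \<kappa> \<eta> by unfold_locales
  have "(LINT z:E|\<kappa> \<Otimes>\<^sub>M \<eta>. a (fst z) * b (snd z)) \<in>
      (\<lambda>E. LINT z:E|\<eta> \<Otimes>\<^sub>M \<kappa>. b (fst z) * a (snd z)) ` sets (\<eta> \<Otimes>\<^sub>M \<kappa>)"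
    if E: "E \<in> sets (\<kappa> \<Otimes>\<^sub>M \<eta>)" for E
  proof
    define E' where "E' = (\<lambda>(y, x). (x, y)) -` E \<inter> space (\<eta> \<Otimes>\<^sub>M \<kappa>)"
    show "E' \<in> sets (\<eta> \<Otimes>\<^sub>M \<kappa>)"
      unfolding E'_def using measurable_pair_swap' E by (rule measurable_sets)
    have "(LINT z:E|\<kappa> \<Otimes>\<^sub>M \<eta>. a (fst z) * b (snd z)) =
        (\<integral>(y, x). indicator E (x, y) *\<^sub>R (a x * b y) \<partial>(\<eta> \<Otimes>\<^sub>M \<kappa>))"
      using integral_product_swap[of "\<lambda>z. indicator E z *\<^sub>R (a (fst z) * b (snd z))"]
        integrable_indicator_scaleR[OF integrable_product_vec[OF fin a b] E]
      by (simp add: set_lebesgue_integral_def)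
    also have "\<dots> = (LINT z:E'|\<eta> \<Otimes>\<^sub>M \<kappa>. b (fst z) * a (snd z))"
      unfolding set_lebesgue_integral_def
      by (intro Bochner_Integration.integral_cong)
        (auto simp: E'_def indicator_def mult.commute split: prod.splits)
    finally show "(LINT z:E|\<kappa> \<Otimes>\<^sub>M \<eta>. a (fst z) * b (snd z)) =
        (LINT z:E'|\<eta> \<Otimes>\<^sub>M \<kappa>. b (fst z) * a (snd z))" .
  qed
  then show ?thesis
    unfolding lorenz_hull_def by (intro hull_mono) auto
qed

lemma product_hull_commute:
  fixes a :: "'a \<Rightarrow> real ^ 'n" and b :: "'b \<Rightarrow> real ^ 'n"
  assumes "finite_measure \<kappa>" "finite_measure \<eta>" "integrable \<kappa> a" "integrable \<eta> b"
  shows "lorenz_hull (\<kappa> \<Otimes>\<^sub>M \<eta>) (\<lambda>E. LINT z:E|\<kappa> \<Otimes>\<^sub>M \<eta>. a (fst z) * b (snd z))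
    = lorenz_hull (\<eta> \<Otimes>\<^sub>M \<kappa>) (\<lambda>E. LINT z:E|\<eta> \<Otimes>\<^sub>M \<kappa>. b (fst z) * a (snd z))"
  using assms by (intro equalityI product_hull_swap_subset)

section \<open>Monotonicity of the Lorenz product\<close>

lemma lorenz_hull_cong:
  assumes "sets M = sets N" "\<And>A. A \<in> sets N \<Longrightarrow> \<mu> A = \<nu> A"
  shows "lorenz_hull M \<mu> = lorenz_hull N \<nu>"
  unfolding lorenz_hull_def using assms by (metis (no_types, lifting) image_cong)

lemma lorenz_product_densities:
  fixes H H' P :: "(real ^ 'n) set"
  assumes "is_lorenz_product TYPE('a) TYPE('b) H H' P"
  obtains \<kappa> :: "'a measure" and a and \<eta> :: "'b measure" and b
  where "finite_measure \<kappa>" "finite_measure \<eta>" "integrable \<kappa> a" "integrable \<eta> b"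
    "H = lorenz_hull \<kappa> (\<lambda>A. LINT x:A|\<kappa>. a x)" "H' = lorenz_hull \<eta> (\<lambda>B. LINT y:B|\<eta>. b y)"
    "P = lorenz_hull (\<kappa> \<Otimes>\<^sub>M \<eta>) (\<lambda>E. LINT z:E|\<kappa> \<Otimes>\<^sub>M \<eta>. a (fst z) * b (snd z))"
proof -
  obtain M :: "'a measure" and \<alpha> and N :: "'b measure" and \<beta>
    where \<alpha>: "signed_vector_measure M \<alpha>" and \<beta>: "signed_vector_measure N \<beta>"
      and H: "H = lorenz_hull M \<alpha>" "H' = lorenz_hull N \<beta>"
        "P = lorenz_hull (M \<Otimes>\<^sub>M N) (vector_product M \<alpha> N \<beta>)"
    using assms unfolding is_lorenz_product_def by blast
  obtain \<kappa> a where \<kappa>: "finite_measure \<kappa>" "sets \<kappa> = sets M" "integrable \<kappa> a"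
      "\<And>A. A \<in> sets M \<Longrightarrow> \<alpha> A = (LINT x:A|\<kappa>. a x)"
    using signed_vector_measure_density[OF \<alpha>] by blast
  obtain \<eta> b where \<eta>: "finite_measure \<eta>" "sets \<eta> = sets N" "integrable \<eta> b"
      "\<And>B. B \<in> sets N \<Longrightarrow> \<beta> B = (LINT y:B|\<eta>. b y)"
    using signed_vector_measure_density[OF \<beta>] by blast
  have pair: "sets (\<kappa> \<Otimes>\<^sub>M \<eta>) = sets (M \<Otimes>\<^sub>M N)"
    using \<kappa>(2) \<eta>(2) by (rule sets_pair_measure_cong)
  show ?thesis
  proof (rule that[OF \<kappa>(1) \<eta>(1) \<kappa>(3) \<eta>(3)])
    show "H = lorenz_hull \<kappa> (\<lambda>A. LINT x:A|\<kappa>. a x)"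
      unfolding H by (rule lorenz_hull_cong) (use \<kappa> in auto)
    show "H' = lorenz_hull \<eta> (\<lambda>B. LINT y:B|\<eta>. b y)"
      unfolding H by (rule lorenz_hull_cong) (use \<eta> in auto)
    show "P = lorenz_hull (\<kappa> \<Otimes>\<^sub>M \<eta>) (\<lambda>E. LINT z:E|\<kappa> \<Otimes>\<^sub>M \<eta>. a (fst z) * b (snd z))"
      unfolding H using pair
      by (intro lorenz_hull_cong vector_product_eq_set_integral \<kappa> \<eta>) auto
  qed
qed

theorem theorem3:
  fixes H1 H2 H3 H4 H12 H34 :: "(real ^ 'n) set"
  assumes "is_lorenz_hull TYPE('a) H1" and "is_lorenz_hull TYPE('b) H2"
    and "is_lorenz_hull TYPE('c) H3" and "is_lorenz_hull TYPE('d) H4"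
    and "is_lorenz_product TYPE('a) TYPE('b) H1 H2 H12"
    and "is_lorenz_product TYPE('c) TYPE('d) H3 H4 H34"
    and "H1 \<subseteq> H3" and "H2 \<subseteq> H4"
  shows "H12 \<subseteq> H34"
proof -
  obtain \<kappa> :: "'a measure" and a and \<eta> :: "'b measure" and b
    where fin: "finite_measure \<kappa>" "finite_measure \<eta>" and ab: "integrable \<kappa> a" "integrable \<eta> b"
      and H12: "H1 = lorenz_hull \<kappa> (\<lambda>A. LINT x:A|\<kappa>. a x)"
        "H2 = lorenz_hull \<eta> (\<lambda>B. LINT y:B|\<eta>. b y)"
        "H12 = lorenz_hull (\<kappa> \<Otimes>\<^sub>M \<eta>) (\<lambda>E. LINT z:E|\<kappa> \<Otimes>\<^sub>M \<eta>. a (fst z) * b (snd z))"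
    using assms(5) by (rule lorenz_product_densities)
  obtain \<kappa>' :: "'c measure" and a' and \<eta>' :: "'d measure" and b'
    where fin': "finite_measure \<kappa>'" "finite_measure \<eta>'" and ab': "integrable \<kappa>' a'" "integrable \<eta>' b'"
      and H34: "H3 = lorenz_hull \<kappa>' (\<lambda>A. LINT x:A|\<kappa>'. a' x)"
        "H4 = lorenz_hull \<eta>' (\<lambda>B. LINT y:B|\<eta>'. b' y)"
        "H34 = lorenz_hull (\<kappa>' \<Otimes>\<^sub>M \<eta>') (\<lambda>E. LINT z:E|\<kappa>' \<Otimes>\<^sub>M \<eta>'. a' (fst z) * b' (snd z))"
    using assms(6) by (rule lorenz_product_densities)
  have "H12 \<subseteq> lorenz_hull (\<kappa>' \<Otimes>\<^sub>M \<eta>) (\<lambda>E. LINT z:E|\<kappa>' \<Otimes>\<^sub>M \<eta>. a' (fst z) * b (snd z))"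
    unfolding H12(3)
    using product_hull_mono_left[OF fin fin'(1) ab ab'(1)] assms(7) H12(1) H34(1) by simp
  also have "\<dots> = lorenz_hull (\<eta> \<Otimes>\<^sub>M \<kappa>') (\<lambda>E. LINT z:E|\<eta> \<Otimes>\<^sub>M \<kappa>'. b (fst z) * a' (snd z))"
    by (rule product_hull_commute[OF fin'(1) fin(2) ab'(1) ab(2)])
  also have "\<dots> \<subseteq> lorenz_hull (\<eta>' \<Otimes>\<^sub>M \<kappa>') (\<lambda>E. LINT z:E|\<eta>' \<Otimes>\<^sub>M \<kappa>'. b' (fst z) * a' (snd z))"
    using product_hull_mono_left[OF fin(2) fin'(1,2) ab(2) ab'(1,2)] assms(8) H12(2) H34(2) by simp
  also have "\<dots> = H34"
    unfolding H34(3) by (rule product_hull_commute[OF fin'(2,1) ab'(2,1)])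
  finally show ?thesis .
qed

end
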